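(* Let the polynomials $p_n$ be defined by $p_0(\alpha)=1$ and $p_{n+1}(\alpha)=\frac{\alpha}{n+1}\sum_{k=0}^n\frac{k+1}{k+2}p_{n-k}(\alpha)$ for $n\ge0$. For $\alpha>0$ and $n\ge0$ one has $p_n(\alpha)>0$ and $$\frac{p_{n+1}(\alpha)}{p_n(\alpha)}\le\widehat\alpha:=\begin{cases}1,&0\le\alpha\le1,\\2\alpha,&1<\alpha<2,\\\alpha,&2\le\alpha.\end{cases}$$ Consequently, for every $s>0$, the series $$e^\alpha\sum_{n=0}^\infty(-1)^np_{n+1}(\alpha)\frac{s^n}{n!}$$ satisfies the hypotheses of the Alternating Series Test for $n\ge\widehat\alpha s$: the absolute values $p_{n+1}(\alpha)s^n/n!$ of the terms (up to the factor $e^\alpha$) are non-increasing in $n$ for $n\ge\widehat\alpha s$ and tend to $0$ (so that truncating the series beyond such an index gives an error bounded by the absolute value of the first omitted term). *)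

theory Defs
  imports "HOL-Analysis.Analysis" "HOL-Computational_Algebra.Polynomial"
begin

fun p :: "nat \<Rightarrow> real poly" where
  "p 0 = 1"
| "p (Suc n) =
     smult (1 / real (n + 1)) ([:0, 1:] * (\<Sum>k = 0..n. smult (real (k + 1) / real (k + 2)) (p (n - k))))"

lemma poly_p_0: "poly (p 0) \<alpha> = 1"
  by simp

lemma poly_p_Suc:
  "poly (p (n + 1)) \<alpha> =
     \<alpha> / real (n + 1) * (\<Sum>k = 0..n. real (k + 1) / real (k + 2) * poly (p (n - k)) \<alpha>)"
  by (simp add: poly_sum)

text \<open>The intended domain is \<open>\<alpha> \<ge> 0\<close>; the value 1 at negative arguments is a junk value.\<close>

definition alpha_hat :: "real \<Rightarrow> real" where
  "alpha_hat \<alpha> = (if \<alpha> \<le> 1 then 1 else if \<alpha> < 2 then 2 * \<alpha> else \<alpha>)"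

end

theory Submission
  imports Defs
begin

text \<open>
  Write \<open>g\<^sub>k = (k + 1) / (k + 2)\<close>, so that \<open>(n + 1) p\<^sub>n\<^sub>+\<^sub>1 = \<alpha> \<Sum>\<^sub>k g\<^sub>k p\<^sub>n\<^sub>-\<^sub>k\<close>. Positivity is
  immediate from the positivity of the \<open>g\<^sub>k\<close>. The bound on the ratio has two regimes.

  For \<open>\<alpha> > 1\<close> a crude comparison is enough: \<open>g\<^sub>k\<^sub>+\<^sub>1 \<le> 4/3 g\<^sub>k\<close>, so shifting the convolution by one
  place gives \<open>(n + 1) p\<^sub>n\<^sub>+\<^sub>1 \<le> (\<alpha>/2 + 4n/3) p\<^sub>n\<close>. Hence the ratio is at most \<open>max (\<alpha>/2) (4/3)\<close>,
  which lies below \<open>2\<alpha>\<close> if \<open>\<alpha> \<ge> 1\<close> and below \<open>\<alpha>\<close> if \<open>\<alpha> \<ge> 2\<close>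
  (lemma \<open>poly_p_Suc_le_crude\<close>).

  For \<open>\<alpha> \<le> 1\<close> the claim is that \<open>p\<^sub>n\<close> is non-increasing, and this is delicate because the ratio
  tends to 1. In terms of generating functions, the recursion says
  \<open>P' = \<alpha> G P\<close> with \<open>G(x) = \<Sum>\<^sub>k g\<^sub>k x\<^sup>k\<close>, so \<open>D(x) = (1 - x) P(x)\<close> satisfies \<open>D' = - B D\<close> with
  \<open>B(x) = 1 / (1 - x) - \<alpha> G(x)\<close>, whose coefficients are
  \<open>b\<^sub>k = 1 - \<alpha> g\<^sub>k = (1 - \<alpha>) + \<alpha> / (k + 2)\<close>. These are positive and log-convex, as a sum of two
  log-convex sequences. An argument in the style of Kaluza's theorem on reciprocals of power series
  with log-convex coefficients then shows that every coefficient \<open>p\<^sub>n - p\<^sub>n\<^sub>-\<^sub>1\<close>, \<open>n \<ge> 1\<close>, of \<open>D\<close> is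
  non-positive (lemma \<open>log_convex_exp_coeff_nonpos\<close>).

  Once the ratio is bounded, consecutive terms \<open>p\<^sub>n\<^sub>+\<^sub>1 s\<^sup>n / n!\<close> have quotient at most
  \<open>alpha_hat \<alpha> * s / (n + 1)\<close>, and the terms are dominated by those of an exponential series. The
  rest is Leibniz's criterion applied to the tail of the series.
\<close>

section \<open>A Kaluza-type sign lemma\<close>

text \<open>
  The hypotheses say that \<open>D(x) = \<Sum>\<^sub>n d\<^sub>n x\<^sup>n\<close> is a non-negative multiple of \<open>exp (- \<integral> B)\<close>, where \<open>B\<close> has
  coefficients \<open>b\<^sub>k\<close>. Subtracting \<open>b\<^sub>n\<^sub>+\<^sub>1 / b\<^sub>n\<close> times the recursion for index \<open>n + 1\<close> from
  that for \<open>n + 2\<close> cancels the only term with a positive \<open>d\<close>, namely \<open>d\<^sub>0\<close>; log-convexity is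
  exactly what gives the surviving coefficients the right sign, and \<open>b\<^sub>0\<^sup>2 \<le> b\<^sub>1\<close> handles the
  contribution of \<open>d\<^sub>n\<^sub>+\<^sub>1\<close> itself.
\<close>

lemma log_convex_exp_coeff_nonpos:
  fixes b d :: "nat \<Rightarrow> real"
  assumes b_pos: "\<And>k. b k > 0"
    and log_convex: "\<And>k. (b (Suc k))\<^sup>2 \<le> b k * b (Suc (Suc k))"
    and b_start: "(b 0)\<^sup>2 \<le> b 1"
    and d0: "d 0 \<ge> 0"
    and rec: "\<And>n. real (Suc n) * d (Suc n) = - (\<Sum>k\<le>n. b k * d (n - k))"
  shows "d (Suc n) \<le> 0"
proof (induction n rule: less_induct)
  case (less n)
  define q where "q k = b (Suc k) / b k" for k
  have "q k \<le> q (Suc k)" for k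
    using log_convex[of k] b_pos[of k] b_pos[of "Suc k"]
    by (simp add: q_def field_simps power2_eq_square)
  hence q_mono: "q i \<le> q j" if "i \<le> j" for i j
    using that by (rule lift_Suc_mono_le)
  show ?case
  proof (cases n)
    case 0
    then show ?thesis
      using rec[of 0] b_pos[of 0] d0 by simp
  next
    case (Suc m)
    have step: "real (Suc (Suc m)) * d (Suc (Suc m)) =
        (q m * real (Suc m) - b 0) * d (Suc m)
        + (\<Sum>k\<le>m. (q m * b k - b (Suc k)) * d (m - k))"
    proof -
      have "real (Suc (Suc m)) * d (Suc (Suc m)) =
          - b 0 * d (Suc m) - (\<Sum>k\<le>m. b (Suc k) * d (m - k))"
        unfolding rec[of "Suc m"] sum.atMost_Suc_shift by simp
      moreover have "q m * (real (Suc m) * d (Suc m)) = - (\<Sum>k\<le>m. q m * b k * d (m - k))"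
        unfolding rec[of m] by (simp add: sum_distrib_left mult.assoc)
      ultimately show ?thesis
        by (simp add: algebra_simps sum_subtractf)
    qed
    have "b 0 \<le> q 0"
      using b_start b_pos[of 0] by (simp add: q_def field_simps power2_eq_square)
    also have "\<dots> \<le> q m"
      by (rule q_mono) simp
    also have "\<dots> \<le> q m * real (Suc m)"
      using b_pos[of m] b_pos[of "Suc m"] by (simp add: q_def field_simps)
    finally have "(q m * real (Suc m) - b 0) * d (Suc m) \<le> 0"
      using less.IH[of m] Suc by (intro mult_nonneg_nonpos) auto
    moreover have "(q m * b k - b (Suc k)) * d (m - k) \<le> 0" if "k \<le> m" for k
    proof (cases "k = m")
      case True
      then show ?thesis
        using b_pos[of m] by (simp add: q_def)
    next
      case False
      with that have "d (m - k) \<le> 0"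
        using less.IH[of "m - k - 1"] Suc by (simp add: Suc_diff_Suc)
      moreover have "b (Suc k) = q k * b k"
        using b_pos[of k] by (simp add: q_def)
      hence "b (Suc k) \<le> q m * b k"
        using q_mono[OF that] b_pos[of k] by (simp add: mult_right_mono)
      ultimately show ?thesis
        by (intro mult_nonneg_nonpos) auto
    qed
    hence "(\<Sum>k\<le>m. (q m * b k - b (Suc k)) * d (m - k)) \<le> 0"
      by (intro sum_nonpos) auto
    ultimately have "real (Suc (Suc m)) * d (Suc (Suc m)) \<le> 0"
      unfolding step by linarith
    then show ?thesis
      using Suc by (simp add: mult_le_0_iff)
  qed
qed

section \<open>The ratio of consecutive polynomials\<close>

lemma poly_p_recurrence:
  "real (Suc n) * poly (p (Suc n)) \<alpha> =
     \<alpha> * (\<Sum>k\<le>n. real (k + 1) / real (k + 2) * poly (p (n - k)) \<alpha>)"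
proof -
  have "poly (p (Suc n)) \<alpha> =
      \<alpha> / real (Suc n) * (\<Sum>k\<le>n. real (k + 1) / real (k + 2) * poly (p (n - k)) \<alpha>)"
    using poly_p_Suc[of n \<alpha>] unfolding atMost_atLeast0 Suc_eq_plus1 .
  then show ?thesis
    by (simp del: p.simps)
qed

lemma poly_p_pos:
  assumes "\<alpha> > 0"
  shows "poly (p n) \<alpha> > 0"
proof (induction n rule: less_induct)
  case (less n)
  show ?case
  proof (cases n)
    case (Suc m)
    have "(\<Sum>k\<le>m. real (k + 1) / real (k + 2) * poly (p (m - k)) \<alpha>) > 0"
      using less.IH Suc by (intro sum_pos) auto
    hence "real (Suc m) * poly (p (Suc m)) \<alpha> > 0"
      unfolding poly_p_recurrence using assms by simp
    then show ?thesis
      unfolding Suc by (simp add: zero_less_mult_iff del: p.simps)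
  qed simp
qed

lemma poly_p_Suc_le_crude:
  assumes "\<alpha> > 0"
  shows "poly (p (Suc n)) \<alpha> \<le> max (\<alpha> / 2) (4 / 3) * poly (p n) \<alpha>"
proof (cases n)
  case 0
  have "poly (p (Suc 0)) \<alpha> = \<alpha> / 2 * poly (p 0) \<alpha>"
    by simp
  also have "\<dots> \<le> max (\<alpha> / 2) (4 / 3) * poly (p 0) \<alpha>"
    by (intro mult_right_mono) auto
  finally show ?thesis
    unfolding 0 .
next
  case (Suc m)
  define P where "P k = poly (p k) \<alpha>" for k
  define M where "M = max (\<alpha> / 2) (4 / 3 :: real)"
  have P_pos: "P k > 0" for k
    unfolding P_def using assms by (rule poly_p_pos)
  have "real (Suc n) * P (Suc n) =
      \<alpha> / 2 * P n + \<alpha> * (\<Sum>k\<le>m. real (k + 2) / real (k + 3) * P (m - k))"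
    unfolding P_def poly_p_recurrence Suc sum.atMost_Suc_shift
    by (simp add: algebra_simps numeral_3_eq_3 del: p.simps)
  also have "\<dots> \<le> \<alpha> / 2 * P n + \<alpha> * (\<Sum>k\<le>m. 4 / 3 * (real (k + 1) / real (k + 2) * P (m - k)))"
  proof -
    \<comment> \<open>\<open>(k + 2)\<^sup>2 / ((k + 1) (k + 3)) = 1 + 1 / ((k + 1) (k + 3))\<close> is largest at \<open>k = 0\<close>.\<close>
    have "real (k + 2) / real (k + 3) \<le> 4 / 3 * (real (k + 1) / real (k + 2))" for k
      by (simp add: divide_simps) (simp add: algebra_simps)
    hence "real (k + 2) / real (k + 3) * P (m - k) \<le>
        4 / 3 * (real (k + 1) / real (k + 2) * P (m - k))" for k
      unfolding mult.assoc[symmetric] using P_pos[of "m - k"] by (intro mult_right_mono) auto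
    then show ?thesis
      using assms by (intro add_left_mono mult_left_mono sum_mono) simp_all
  qed
  also have "\<dots> = \<alpha> / 2 * P n + 4 / 3 * (real n * P n)"
    unfolding P_def Suc poly_p_recurrence by (simp add: sum_distrib_left mult_ac)
  also have "\<dots> \<le> M * P n + M * (real n * P n)"
    using P_pos[of n] by (intro add_mono mult_right_mono) (auto simp: M_def)
  also have "\<dots> = real (Suc n) * (M * P n)"
    by (simp add: algebra_simps)
  finally show ?thesis
    unfolding P_def M_def by (simp only: mult_le_cancel_left_pos of_nat_0_less_iff zero_less_Suc)
qed

text \<open>
  The differences \<open>d\<^sub>n = p\<^sub>n - p\<^sub>n\<^sub>-\<^sub>1\<close> are the coefficients of \<open>(1 - x) P(x)\<close>; with the convention
  \<open>p\<^sub>-\<^sub>1 = 0\<close> they satisfy the recursion of \<open>log_convex_exp_coeff_nonpos\<close> for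
  \<open>b\<^sub>k = 1 - \<alpha> (k + 1) / (k + 2)\<close>. The summand 1 in \<open>b\<^sub>k\<close> comes from writing \<open>p\<^sub>n\<close> as the
  telescoping sum of the differences.
\<close>

lemma poly_p_Suc_le:
  assumes "0 < \<alpha>" "\<alpha> \<le> 1"
  shows "poly (p (Suc n)) \<alpha> \<le> poly (p n) \<alpha>"
proof -
  define P where "P k = poly (p k) \<alpha>" for k
  define d where "d k = (case k of 0 \<Rightarrow> P 0 | Suc j \<Rightarrow> P (Suc j) - P j)" for k
  define g where "g k = real (k + 1) / real (k + 2)" for k
  define b where "b k = 1 - \<alpha> * g k" for k
  have b_eq: "b k = (1 - \<alpha>) + \<alpha> / real (k + 2)" for k
    by (simp add: b_def g_def field_simps)
  have P_rec: "real (Suc m) * P (Suc m) = \<alpha> * (\<Sum>k\<le>m. g k * P (m - k))" for m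
    unfolding P_def g_def by (rule poly_p_recurrence)
  have telescope: "(\<Sum>k\<le>m. d (m - k)) = P m" for m
  proof -
    have "(\<Sum>k\<le>m. d (m - k)) = (\<Sum>k\<le>m. d k)"
      by (rule sum.nat_diff_reindex[of d "Suc m", simplified lessThan_Suc_atMost, simplified])
    also have "\<dots> = P m"
      by (induction m) (auto simp: d_def)
    finally show ?thesis .
  qed
  have convolve: "\<alpha> * (\<Sum>k\<le>m. g k * d (m - k)) = real (Suc m) * P (Suc m) - real m * P m" for m
  proof (cases m)
    case 0
    then show ?thesis
      by (simp add: P_rec[of 0, simplified] d_def)
  next
    case (Suc l)
    have "(\<Sum>k\<le>m. g k * d (m - k)) = (\<Sum>k\<le>l. g k * (P (m - k) - P (l - k))) + g m * P 0"
      unfolding Suc by (simp add: d_def Suc_diff_le)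
    also have "\<dots> = (\<Sum>k\<le>m. g k * P (m - k)) - (\<Sum>k\<le>l. g k * P (l - k))"
      by (simp add: Suc right_diff_distrib sum_subtractf)
    finally show ?thesis
      unfolding Suc by (simp only: P_rec right_diff_distrib)
  qed
  have "d (Suc n) \<le> 0"
  proof (rule log_convex_exp_coeff_nonpos[of b])
    show "b k > 0" for k
      using assms by (auto simp: b_eq intro: add_nonneg_pos)
    show "(b (Suc k))\<^sup>2 \<le> b k * b (Suc (Suc k))" for k
    proof -
      define x where "x = real (k + 3)"
      define u v w where "u = 1 / (x - 1)" and "v = 1 / x" and "w = 1 / (x + 1)"
      have "x > 1"
        by (simp add: x_def)
      \<comment> \<open>After expansion, the constant part is equal on both sides, and the other parts
        express the convexity and the log-convexity of \<open>x \<mapsto> 1 / x\<close>.\<close>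
      hence conv: "2 * v \<le> u + w" and logconv: "v\<^sup>2 \<le> u * w"
        using mult_strict_mono[of 1 x 1 x] unfolding u_def v_def w_def
        by (simp_all add: divide_simps) (simp_all add: algebra_simps power2_eq_square)
      have "b k = (1 - \<alpha>) + \<alpha> * u" "b (Suc k) = (1 - \<alpha>) + \<alpha> * v"
        "b (Suc (Suc k)) = (1 - \<alpha>) + \<alpha> * w"
        by (simp_all add: b_eq x_def u_def v_def w_def)
      hence "b k * b (Suc (Suc k)) - (b (Suc k))\<^sup>2 =
          (1 - \<alpha>) * \<alpha> * (u + w - 2 * v) + \<alpha>\<^sup>2 * (u * w - v\<^sup>2)"
        by (simp only:) (simp add: algebra_simps power2_eq_square)
      also have "\<dots> \<ge> 0"
        using conv logconv assms by (intro add_nonneg_nonneg mult_nonneg_nonneg) auto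
      finally show ?thesis
        by simp
    qed
    have "\<alpha> * \<alpha> \<le> \<alpha> * 1"
      using assms by (intro mult_left_mono) auto
    then show "(b 0)\<^sup>2 \<le> b 1"
      using assms by (simp add: b_eq field_simps power2_eq_square)
    show "d 0 \<ge> 0"
      by (simp add: d_def P_def)
    show "real (Suc m) * d (Suc m) = - (\<Sum>k\<le>m. b k * d (m - k))" for m
    proof -
      have "(\<Sum>k\<le>m. b k * d (m - k)) = P m - \<alpha> * (\<Sum>k\<le>m. g k * d (m - k))"
        unfolding telescope[symmetric]
        by (simp add: b_def left_diff_distrib sum_subtractf sum_distrib_left mult.assoc)
      then show ?thesis
        unfolding convolve by (simp add: d_def algebra_simps)
    qed
  qed
  then show ?thesis
    by (simp add: d_def P_def del: p.simps)
qed

lemma alpha_hat_pos: "alpha_hat \<alpha> > 0"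
  by (simp add: alpha_hat_def)

lemma poly_p_Suc_le_alpha_hat:
  assumes "\<alpha> > 0"
  shows "poly (p (Suc n)) \<alpha> \<le> alpha_hat \<alpha> * poly (p n) \<alpha>"
proof (cases "\<alpha> \<le> 1")
  case True
  then show ?thesis
    using poly_p_Suc_le[OF assms True] by (simp add: alpha_hat_def del: p.simps)
next
  case False
  hence "max (\<alpha> / 2) (4 / 3) \<le> alpha_hat \<alpha>"
    by (auto simp: alpha_hat_def)
  hence "max (\<alpha> / 2) (4 / 3) * poly (p n) \<alpha> \<le> alpha_hat \<alpha> * poly (p n) \<alpha>"
    using poly_p_pos[OF assms] by (simp only: mult_le_cancel_right_pos)
  with poly_p_Suc_le_crude[OF assms] show ?thesis
    by (rule order_trans)
qed

section \<open>The alternating series\<close>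

text \<open>
  Leibniz's criterion for a sequence that decreases only from some index on: it is applied to the
  tail, whose value lies between 0 and its first term up to the sign \<open>(-1) ^ N\<close>.
\<close>

lemma alternating_series_eventually_antimono:
  fixes a :: "nat \<Rightarrow> real"
  assumes lim: "a \<longlonglongrightarrow> 0" and nonneg: "\<And>n. a n \<ge> 0"
    and mono: "antimono_on {N..} a"
  shows "summable (\<lambda>n. (-1) ^ n * a n)"
    and "\<bar>(\<Sum>n. (-1) ^ n * a n) - (\<Sum>n<N. (-1) ^ n * a n)\<bar> \<le> a N"
proof -
  let ?t = "\<lambda>n. a (n + N)"
  have t: "?t \<longlonglongrightarrow> 0" "\<And>n. 0 \<le> ?t n" "\<And>n. ?t (Suc n) \<le> ?t n"
    using lim nonneg mono by (auto simp: LIMSEQ_ignore_initial_segment monotone_on_def)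
  note Leibniz = summable_Leibniz'[OF t]
  have shift: "(-1) ^ (n + N) * a (n + N) = (-1) ^ N * ((-1) ^ n * ?t n)" for n
    by (simp add: power_add)
  have "summable (\<lambda>n. (-1) ^ (n + N) * a (n + N))"
    unfolding shift using Leibniz(1) by (rule summable_mult)
  then show summable: "summable (\<lambda>n. (-1) ^ n * a n)"
    by (subst (asm) summable_iff_shift)
  have "(\<Sum>n. (-1) ^ n * a n) - (\<Sum>n<N. (-1) ^ n * a n) = (\<Sum>n. (-1) ^ (n + N) * a (n + N))"
    using suminf_minus_initial_segment[OF summable, of N] by simp
  also have "\<dots> = (-1) ^ N * (\<Sum>n. (-1) ^ n * ?t n)"
    unfolding shift using Leibniz(1) by (rule suminf_mult)
  finally show "\<bar>(\<Sum>n. (-1) ^ n * a n) - (\<Sum>n<N. (-1) ^ n * a n)\<bar> \<le> a N"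
    using Leibniz(2)[of 0] Leibniz(4)[of 0] by (simp add: abs_mult)
qed

lemma terms_antimono:
  assumes "\<alpha> > 0" "s > 0"
  shows "antimono_on {n. real n \<ge> alpha_hat \<alpha> * s} (\<lambda>n. poly (p (n + 1)) \<alpha> * (s ^ n / fact n))"
    (is "antimono_on _ ?a")
proof -
  have quotient: "?a (Suc n) \<le> ?a n" if n: "real n \<ge> alpha_hat \<alpha> * s" for n
  proof -
    have "?a (Suc n) \<le> alpha_hat \<alpha> * poly (p (n + 1)) \<alpha> * (s ^ Suc n / fact (Suc n))"
      using poly_p_Suc_le_alpha_hat[OF assms(1), of "Suc n"] assms(2)
      by (intro mult_right_mono) (auto simp del: p.simps)
    also have "\<dots> = ?a n * (alpha_hat \<alpha> * s / real (Suc n))"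
      by (simp add: field_simps del: p.simps)
    also have "\<dots> \<le> ?a n * 1"
      using n assms(2) poly_p_pos[OF assms(1), of "n + 1"]
      by (intro mult_left_mono) (auto simp del: p.simps)
    finally show ?thesis
      by simp
  qed
  show ?thesis
  proof (rule monotone_onI)
    fix m n :: nat
    assume m: "m \<in> {n. real n \<ge> alpha_hat \<alpha> * s}" and "m \<le> n"
    from \<open>m \<le> n\<close> show "?a n \<le> ?a m"
    proof (induction n rule: dec_induct)
      case (step k)
      have "?a (Suc k) \<le> ?a k"
        using m step.hyps(1) by (intro quotient) auto
      with step.IH show ?case
        by simp
    qed simp
  qed
qed

text \<open>
  Iterating the ratio bound gives \<open>p\<^sub>n \<le> (alpha_hat \<alpha>)\<^sup>n\<close>, so the terms are dominated by those of
  the exponential series at \<open>alpha_hat \<alpha> * s\<close>.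
\<close>

lemma terms_tendsto_0:
  assumes "\<alpha> > 0" "s > 0"
  shows "(\<lambda>n. poly (p (n + 1)) \<alpha> * (s ^ n / fact n)) \<longlonglongrightarrow> 0"
proof (rule tendsto_sandwich[where f = "\<lambda>_. 0"])
  let ?c = "alpha_hat \<alpha>"
  have growth: "poly (p n) \<alpha> \<le> ?c ^ n" for n
  proof (induction n)
    case (Suc n)
    have "?c * poly (p n) \<alpha> \<le> ?c * ?c ^ n"
      using Suc alpha_hat_pos by simp
    with poly_p_Suc_le_alpha_hat[OF assms(1), of n] show ?case
      by (simp del: p.simps)
  qed simp
  have "poly (p (n + 1)) \<alpha> * (s ^ n / fact n) \<le> ?c * ((?c * s) ^ n / fact n)" for n
  proof -
    have "poly (p (n + 1)) \<alpha> * (s ^ n / fact n) \<le> ?c ^ (n + 1) * (s ^ n / fact n)"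
      using growth[of "n + 1"] assms(2) by (intro mult_right_mono) auto
    then show ?thesis
      by (simp add: power_mult_distrib mult.assoc del: p.simps)
  qed
  then show "\<forall>\<^sub>F n in sequentially.
      poly (p (n + 1)) \<alpha> * (s ^ n / fact n) \<le> ?c * ((?c * s) ^ n / fact n)"
    by (intro always_eventually allI)
  show "(\<lambda>n. ?c * ((?c * s) ^ n / fact n)) \<longlonglongrightarrow> 0"
    using summable_LIMSEQ_zero[OF summable_exp[of "?c * s"]]
    by (intro tendsto_mult_right_zero) (simp add: divide_inverse mult.commute)
  show "\<forall>\<^sub>F n in sequentially. 0 \<le> poly (p (n + 1)) \<alpha> * (s ^ n / fact n)"
    using poly_p_pos[OF assms(1)] assms(2)
    by (intro always_eventually allI) (simp add: less_imp_le del: p.simps)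
qed simp

theorem theorem1p6:
  fixes \<alpha> :: real
  assumes "\<alpha> > 0"
  shows "(\<forall>n. poly (p n) \<alpha> > 0 \<and> poly (p (n + 1)) \<alpha> / poly (p n) \<alpha> \<le> alpha_hat \<alpha>) \<and>
    (\<forall>s::real. s > 0 \<longrightarrow>
       antimono_on {n. real n \<ge> alpha_hat \<alpha> * s} (\<lambda>n. poly (p (n + 1)) \<alpha> * (s ^ n / fact n)) \<and>
       (\<lambda>n. poly (p (n + 1)) \<alpha> * (s ^ n / fact n)) \<longlonglongrightarrow> 0 \<and>
       summable (\<lambda>n. (-1) ^ n * poly (p (n + 1)) \<alpha> * (s ^ n / fact n)) \<and>
       (\<forall>N. real N \<ge> alpha_hat \<alpha> * s \<longrightarrow>
          \<bar>exp \<alpha> * (\<Sum>n. (-1) ^ n * poly (p (n + 1)) \<alpha> * (s ^ n / fact n))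
            - exp \<alpha> * (\<Sum>n<N. (-1) ^ n * poly (p (n + 1)) \<alpha> * (s ^ n / fact n))\<bar>
          \<le> \<bar>exp \<alpha> * ((-1) ^ N * poly (p (N + 1)) \<alpha> * (s ^ N / fact N))\<bar>))"
proof (intro conjI allI impI)
  fix n
  show "poly (p n) \<alpha> > 0"
    using assms by (rule poly_p_pos)
  then show "poly (p (n + 1)) \<alpha> / poly (p n) \<alpha> \<le> alpha_hat \<alpha>"
    using poly_p_Suc_le_alpha_hat[OF assms, of n] by (simp add: pos_divide_le_eq del: p.simps)
next
  fix s :: real
  assume s: "s > 0"
  let ?a = "\<lambda>n. poly (p (n + 1)) \<alpha> * (s ^ n / fact n)"
  show mono: "antimono_on {n. real n \<ge> alpha_hat \<alpha> * s} ?a"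
    using assms s by (rule terms_antimono)
  show lim: "?a \<longlonglongrightarrow> 0"
    using assms s by (rule terms_tendsto_0)
  have nonneg: "?a n \<ge> 0" for n
    using poly_p_pos[OF assms, of "n + 1"] s by (simp del: p.simps)
  have mono_from: "antimono_on {N..} ?a" if "real N \<ge> alpha_hat \<alpha> * s" for N
    using mono by (rule monotone_on_subset) (use that in auto)
  obtain N0 where "real N0 \<ge> alpha_hat \<alpha> * s"
    using real_arch_simple by blast
  from alternating_series_eventually_antimono(1)[OF lim nonneg mono_from[OF this]]
  show "summable (\<lambda>n. (-1) ^ n * poly (p (n + 1)) \<alpha> * (s ^ n / fact n))"
    by (simp only: mult.assoc)
  fix N
  assume "real N \<ge> alpha_hat \<alpha> * s"
  from alternating_series_eventually_antimono(2)[OF lim nonneg mono_from[OF this]]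
  have bound: "\<bar>(\<Sum>n. (-1) ^ n * ?a n) - (\<Sum>n<N. (-1) ^ n * ?a n)\<bar> \<le> ?a N" .
  have "\<bar>exp \<alpha> * (\<Sum>n. (-1) ^ n * ?a n) - exp \<alpha> * (\<Sum>n<N. (-1) ^ n * ?a n)\<bar>
      = exp \<alpha> * \<bar>(\<Sum>n. (-1) ^ n * ?a n) - (\<Sum>n<N. (-1) ^ n * ?a n)\<bar>"
    by (simp only: right_diff_distrib[symmetric] abs_mult abs_exp_cancel)
  also have "\<dots> \<le> exp \<alpha> * ?a N"
    using bound by (intro mult_left_mono) auto
  also have "\<dots> = \<bar>exp \<alpha> * ((-1) ^ N * ?a N)\<bar>"
    by (simp only: abs_mult[of "exp \<alpha>"] abs_mult[of "(-1) ^ N"] abs_exp_cancel power_abs abs_minus_cancel abs_one power_one mult_1_left abs_of_nonneg[OF nonneg])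
  finally show "\<bar>exp \<alpha> * (\<Sum>n. (-1) ^ n * poly (p (n + 1)) \<alpha> * (s ^ n / fact n))
        - exp \<alpha> * (\<Sum>n<N. (-1) ^ n * poly (p (n + 1)) \<alpha> * (s ^ n / fact n))\<bar>
      \<le> \<bar>exp \<alpha> * ((-1) ^ N * poly (p (N + 1)) \<alpha> * (s ^ N / fact N))\<bar>"
    by (simp only: mult.assoc)
qed

end
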